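(* No perfect graph is ugly. That is, for every connected perfect graph $G$ there exists a connected ordering $\sigma$ of $V(G)$ such that the greedy colouring of $G$ relative to $\sigma$ uses exactly $\chi(G)$ colours.
   Context: Graphs are finite and simple. A graph is perfect if for each of its induced subgraphs the chromatic number equals the clique number. Given an ordering $\sigma: v_1,\dots,v_n$ of the vertices of $G$, the greedy colouring relative to $\sigma$ colours $v_1,\dots,v_n$ in this order, assigning to each vertex the smallest positive integer not used by its already coloured neighbours; $\chi(G,\sigma)$ denotes the number of colours it uses. An ordering $v_1,\dots,v_n$ is connected if for every $i$ the subgraph induced by $v_1,\dots,v_i$ is connected. For a connected graph $G$, $\chi_c(G)$ is the minimum of $\chi(G,\sigma)$ over all connected orderings $\sigma$ of $V(G)$; a connected graph $G$ is ugly if $\chi_c(G)>\chi(G)$. *)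

theory Defs
  imports "Graph_Theory.Digraph_Component"
begin

text \<open>
  A finite simple graph is an instance of the locale \<^locale>\<open>graph\<close>: a finite, loop-free
  symmetric digraph without parallel arcs, where an undirected edge is a pair of opposite arcs.
  The predicate \<^const>\<open>connected\<close> requires at least one vertex.
\<close>

definition proper_colouring :: "('a, 'b) pre_digraph \<Rightarrow> ('a \<Rightarrow> nat) \<Rightarrow> bool" where
  "proper_colouring G c \<longleftrightarrow> (\<forall>u v. u \<rightarrow>\<^bsub>G\<^esub> v \<longrightarrow> c u \<noteq> c v)"

definition chromatic_number :: "('a, 'b) pre_digraph \<Rightarrow> nat" where
  "chromatic_number G = (LEAST k. \<exists>c. proper_colouring G c \<and> c ` verts G \<subseteq> {1..k})"

definition clique :: "('a, 'b) pre_digraph \<Rightarrow> 'a set \<Rightarrow> bool" where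
  "clique G K \<longleftrightarrow> K \<subseteq> verts G \<and> (\<forall>u\<in>K. \<forall>v\<in>K. u \<noteq> v \<longrightarrow> u \<rightarrow>\<^bsub>G\<^esub> v)"

definition clique_number :: "('a, 'b) pre_digraph \<Rightarrow> nat" where
  "clique_number G = Max (card ` {K. clique G K})"

text \<open>
  The null graph counts as an induced subgraph; this is harmless, since both numbers are 0 for it.
\<close>

definition perfect :: "('a, 'b) pre_digraph \<Rightarrow> bool" where
  "perfect G \<longleftrightarrow> (\<forall>H. induced_subgraph H G \<longrightarrow> chromatic_number H = clique_number H)"

definition vertex_ordering :: "('a, 'b) pre_digraph \<Rightarrow> 'a list \<Rightarrow> bool" where
  "vertex_ordering G \<sigma> \<longleftrightarrow> distinct \<sigma> \<and> set \<sigma> = verts G"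

definition connected_ordering :: "('a, 'b) pre_digraph \<Rightarrow> 'a list \<Rightarrow> bool" where
  "connected_ordering G \<sigma> \<longleftrightarrow>
     vertex_ordering G \<sigma> \<and> (\<forall>i\<in>{1..length \<sigma>}. connected (G \<restriction> set (take i \<sigma>)))"

text \<open>
  The map \<open>c\<close> is the partial colouring built so far; vertices outside its domain are uncoloured.
\<close>

definition greedy_step :: "('a, 'b) pre_digraph \<Rightarrow> ('a \<rightharpoonup> nat) \<Rightarrow> 'a \<Rightarrow> ('a \<rightharpoonup> nat)" where
  "greedy_step G c v = c(v \<mapsto> (LEAST k. 1 \<le> k \<and> (\<forall>u. u \<rightarrow>\<^bsub>G\<^esub> v \<longrightarrow> c u \<noteq> Some k)))"

definition greedy_colouring :: "('a, 'b) pre_digraph \<Rightarrow> 'a list \<Rightarrow> ('a \<rightharpoonup> nat)" where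
  "greedy_colouring G \<sigma> = foldl (greedy_step G) Map.empty \<sigma>"

definition greedy_number :: "('a, 'b) pre_digraph \<Rightarrow> 'a list \<Rightarrow> nat" where
  "greedy_number G \<sigma> = card (ran (greedy_colouring G \<sigma>))"

text \<open>
  For a connected finite graph the set below is finite and nonempty, so the minimum is meaningful.
\<close>

definition connected_chromatic_number :: "('a, 'b) pre_digraph \<Rightarrow> nat" where
  "connected_chromatic_number G = Min (greedy_number G ` {\<sigma>. connected_ordering G \<sigma>})"

definition ugly :: "('a, 'b) pre_digraph \<Rightarrow> bool" where
  "ugly G \<longleftrightarrow> connected G \<and> connected_chromatic_number G > chromatic_number G"

end

(*
  Induction on a bound k on the clique number, for a vertex set A connected from a root v.
  Let k = m + 1 and let S be a stable set that avoids v and meets every k-clique of A. By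
  induction each component of A - S has a connected ordering, from any root, whose greedy
  colouring uses at most m colours. Start with the component of v. A vertex of S that is
  adjacent to an m-clique already coloured gets colour m + 1, so the components attached to it
  can be coloured next as if they stood alone, and so on. It remains to choose S such that this
  process reaches all of A. Take S for which the reached part X is largest. If X is not A, then
  perfection gives a colouring of A - X - S with m colours. Replacing S - X by one of its
  colour classes yields another admissible set, for which the process reaches X and also the
  vertices of S - X adjacent to X: a contradiction.
*)
theory Submission
  imports Defs
begin

section \<open>The greedy colouring\<close>

lemma greedy_colouring_Nil [simp]: "greedy_colouring G [] = Map.empty"
  by (simp add: greedy_colouring_def)

lemma dom_greedy_colouring: "dom (greedy_colouring G \<sigma>) = set \<sigma>"
  unfolding greedy_colouring_def
  by (induction \<sigma> rule: rev_induct) (simp_all add: greedy_step_def del: fun_upd_apply)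

text \<open>The least admissible colour exists because only finitely many colours are in use. Later
  proofs work with these characteristic properties instead of \<open>LEAST\<close>.\<close>

lemma greedy_colouring_snoc:
  obtains k where "greedy_colouring G (\<sigma> @ [v]) = (greedy_colouring G \<sigma>)(v \<mapsto> k)" "1 \<le> k"
    "\<And>u. u \<rightarrow>\<^bsub>G\<^esub> v \<Longrightarrow> greedy_colouring G \<sigma> u \<noteq> Some k"
    "\<And>j. \<lbrakk>1 \<le> j; \<And>u. u \<rightarrow>\<^bsub>G\<^esub> v \<Longrightarrow> greedy_colouring G \<sigma> u \<noteq> Some j\<rbrakk> \<Longrightarrow> k \<le> j"
proof -
  let ?c = "greedy_colouring G \<sigma>"
  let ?P = "\<lambda>k. 1 \<le> k \<and> (\<forall>u. u \<rightarrow>\<^bsub>G\<^esub> v \<longrightarrow> ?c u \<noteq> Some k)"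
  have "finite (insert 0 (ran ?c))"
    by (simp add: finite_ran dom_greedy_colouring)
  then obtain k where "k \<notin> insert 0 (ran ?c)"
    using ex_new_if_finite infinite_UNIV_nat by blast
  then have "?P k"
    by (auto simp: ran_def)
  then have "?P (Least ?P)"
    by (rule LeastI)
  moreover have "Least ?P \<le> j" if "?P j" for j
    using that by (rule Least_le)
  ultimately show thesis
    by (intro that[of "Least ?P"]) (auto simp: greedy_colouring_def greedy_step_def)
qed

lemma greedy_colouring_pos:
  "greedy_colouring G \<sigma> v = Some k \<Longrightarrow> 1 \<le> k"
proof (induction \<sigma> arbitrary: v rule: rev_induct)
  case (snoc x \<sigma>)
  obtain k' where "greedy_colouring G (\<sigma> @ [x]) = (greedy_colouring G \<sigma>)(x \<mapsto> k')" "1 \<le> k'"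
    using greedy_colouring_snoc[of G \<sigma> x] by blast
  with snoc show ?case
    by (auto split: if_splits)
qed simp

text \<open>Whichever endpoint comes later avoids the colour of the other. If \<open>v\<close> is
  not in the list, its value is \<open>None\<close>, which differs from the colour of
  \<open>u\<close>.\<close>

lemma (in graph) greedy_colouring_proper:
  assumes "distinct \<sigma>" "u \<rightarrow> v" "u \<in> set \<sigma>"
  shows "greedy_colouring G \<sigma> u \<noteq> greedy_colouring G \<sigma> v"
  using assms
proof (induction \<sigma> arbitrary: u v rule: rev_induct)
  case (snoc x \<sigma>)
  let ?c = "greedy_colouring G \<sigma>"
  obtain k where k: "greedy_colouring G (\<sigma> @ [x]) = ?c(x \<mapsto> k)"
    "\<And>w. w \<rightarrow> x \<Longrightarrow> ?c w \<noteq> Some k"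
    using greedy_colouring_snoc[of G \<sigma> x] by blast
  have "v \<rightarrow> u" "u \<noteq> v"
    using snoc.prems(2) arcs_ends_symmetric[OF sym_arcs] adj_not_same by blast+
  with snoc k show ?case
    by (auto simp: eq_commute[of "Some k"])
qed simp

text \<open>
  Neighbours whose colours exceed everything \<open>\<tau>\<close> uses do not influence the greedy choices on \<open>\<tau>\<close>.
\<close>

lemma greedy_colouring_append:
  assumes "ran (greedy_colouring G \<tau>) \<subseteq> {1..m}"
    and "\<And>u v j. \<lbrakk>u \<rightarrow>\<^bsub>G\<^esub> v; v \<in> set \<tau>; greedy_colouring G \<sigma> u = Some j\<rbrakk> \<Longrightarrow> m < j"
    and "distinct \<tau>" "set \<sigma> \<inter> set \<tau> = {}"
  shows "greedy_colouring G (\<sigma> @ \<tau>) = greedy_colouring G \<sigma> ++ greedy_colouring G \<tau>"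
  using assms
proof (induction \<tau> rule: rev_induct)
  case (snoc x \<tau>)
  let ?c = "greedy_colouring G \<sigma>" and ?d = "greedy_colouring G \<tau>"
  obtain k where k: "greedy_colouring G (\<tau> @ [x]) = ?d(x \<mapsto> k)" "1 \<le> k"
    "\<And>u. u \<rightarrow>\<^bsub>G\<^esub> x \<Longrightarrow> ?d u \<noteq> Some k"
    "\<And>j. \<lbrakk>1 \<le> j; \<And>u. u \<rightarrow>\<^bsub>G\<^esub> x \<Longrightarrow> ?d u \<noteq> Some j\<rbrakk> \<Longrightarrow> k \<le> j"
    using greedy_colouring_snoc[of G \<tau> x] by blast
  have x: "x \<notin> dom ?d" "x \<notin> dom ?c"
    using snoc.prems by (auto simp: dom_greedy_colouring)
  have "ran (?d(x \<mapsto> k)) = insert k (ran ?d)"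
    using x by (simp add: domIff)
  then have ran: "ran ?d \<subseteq> {1..m}" "k \<le> m"
    using snoc.prems(1)[unfolded k(1)] by (simp_all del: fun_upd_apply)
  have IH: "greedy_colouring G (\<sigma> @ \<tau>) = ?c ++ ?d"
    by (rule snoc.IH[OF ran(1) snoc.prems(2)]) (use snoc.prems in auto)
  obtain l where l: "greedy_colouring G (\<sigma> @ \<tau> @ [x]) = (?c ++ ?d)(x \<mapsto> l)" "1 \<le> l"
    "\<And>u. u \<rightarrow>\<^bsub>G\<^esub> x \<Longrightarrow> (?c ++ ?d) u \<noteq> Some l"
    "\<And>j. \<lbrakk>1 \<le> j; \<And>u. u \<rightarrow>\<^bsub>G\<^esub> x \<Longrightarrow> (?c ++ ?d) u \<noteq> Some j\<rbrakk> \<Longrightarrow> l \<le> j"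
    using greedy_colouring_snoc[of G "\<sigma> @ \<tau>" x, unfolded IH append_assoc] by blast
  \<comment> \<open>The colour \<open>k\<close> of \<open>x\<close> after \<open>\<tau>\<close>
    alone is at most \<open>m\<close>, while neighbours of \<open>x\<close> in
    \<open>\<sigma>\<close> have colours above \<open>m\<close>. So \<open>k\<close> stays available
    and \<open>l \<le> k\<close>. Conversely, the presence of \<open>\<sigma>\<close> only forbids
    more colours, hence \<open>k \<le> l\<close>.\<close>
  have "(?c ++ ?d) u \<noteq> Some k" if "u \<rightarrow>\<^bsub>G\<^esub> x" for u
    using k(3)[OF that] snoc.prems(2)[OF that, of k] ran by (auto simp: map_add_Some_iff)
  then have "l \<le> k"
    using k(2) l(4) by blast
  moreover have "?d u \<noteq> Some l" if "u \<rightarrow>\<^bsub>G\<^esub> x" for u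
    using l(3)[OF that] by auto
  then have "k \<le> l"
    using l(2) k(4) by blast
  ultimately show ?case
    using l(1) k(1) by (simp del: fun_upd_apply)
qed simp

section \<open>Connected orderings\<close>

text \<open>Connected orderings with first vertex \<open>v\<close>, in a form that suits induction
  and concatenation: each later vertex has an earlier neighbour.\<close>

inductive search_order :: "('a, 'b) pre_digraph \<Rightarrow> 'a \<Rightarrow> 'a list \<Rightarrow> bool"
  for G :: "('a, 'b) pre_digraph" and v :: 'a where
  root: "search_order G v [v]"
| extend: "\<lbrakk>search_order G v \<sigma>; x \<in> set \<sigma>; x \<rightarrow>\<^bsub>G\<^esub> y; y \<notin> set \<sigma>\<rbrakk> \<Longrightarrow> search_order G v (\<sigma> @ [y])"

lemma search_order_distinct: "search_order G v \<sigma> \<Longrightarrow> distinct \<sigma>"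
  by (induction rule: search_order.induct) auto

lemma search_order_root: "search_order G v \<sigma> \<Longrightarrow> v \<in> set \<sigma>"
  by (induction rule: search_order.induct) auto

lemma search_order_append:
  assumes "search_order G w \<tau>" "search_order G v \<sigma>" "x \<in> set \<sigma>" "x \<rightarrow>\<^bsub>G\<^esub> w" "set \<sigma> \<inter> set \<tau> = {}"
  shows "search_order G v (\<sigma> @ \<tau>)"
  using assms
proof (induction rule: search_order.induct)
  case root
  then show ?case by (auto intro: search_order.extend)
next
  case (extend \<tau> a y)
  then have "search_order G v (\<sigma> @ \<tau>)" by auto
  with extend have "search_order G v ((\<sigma> @ \<tau>) @ [y])"
    by (intro search_order.extend[of _ _ "\<sigma> @ \<tau>" a]) auto
  then show ?case by simp
qed

lemma search_order_take:
  "search_order G v \<sigma> \<Longrightarrow> 1 \<le> i \<Longrightarrow> search_order G v (take i \<sigma>)"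
proof (induction arbitrary: i rule: search_order.induct)
  case root
  then show ?case by (simp add: search_order.root)
next
  case (extend \<sigma> x y)
  then show ?case
    by (cases "i \<le> length \<sigma>") (auto intro: search_order.extend)
qed

text \<open>By induction the root reaches every listed vertex inside the induced subgraph; symmetry
  of the arcs then gives strong connectedness.\<close>

lemma (in graph) search_order_connected:
  assumes "search_order G v \<sigma>" "set \<sigma> \<subseteq> verts G"
  shows "connected (G \<restriction> set \<sigma>)"
proof -
  have reach: "set \<sigma> \<subseteq> verts G \<Longrightarrow> \<forall>x\<in>set \<sigma>. v \<rightarrow>\<^sup>*\<^bsub>G \<restriction> set \<sigma>\<^esub> x"
    using assms(1)
  proof (induction rule: search_order.induct)
    case root
    then show ?case by (auto simp: reachable_def)
  next
    case (extend \<sigma> x y)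
    let ?H = "G \<restriction> set (\<sigma> @ [y])"
    interpret H: wf_digraph ?H
      by (rule wellformed_induce_subgraph)
    have "v \<rightarrow>\<^sup>*\<^bsub>?H\<^esub> z" if "z \<in> set \<sigma>" for z
    proof -
      have "v \<rightarrow>\<^sup>*\<^bsub>G \<restriction> set \<sigma>\<^esub> z" using extend that by simp
      then show ?thesis
        by (rule reachable_induce_ss) auto
    qed
    moreover have "x \<rightarrow>\<^bsub>?H\<^esub> y"
      using extend by (auto simp: arcs_ends_conv)
    ultimately show ?case
      using extend.hyps(2) H.reachable_adj_trans[of v x y] by simp
  qed
  interpret H: sym_digraph "G \<restriction> set \<sigma>"
    by (rule induced_graph_imp_graph) (use assms induced_induce in auto)
  have "strongly_connected (G \<restriction> set \<sigma>)"
    unfolding strongly_connected_def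
    using reach[OF assms(2)] H.symmetric_reachable' H.reachable_trans search_order_root[OF assms(1)]
    by (metis empty_iff induce_subgraph_verts)
  then show ?thesis
    by (auto simp: connected_def strongly_connected_def intro: H.reachable_mk_symmetricI)
qed

section \<open>Perfect graphs\<close>

lemma clique_subset: "clique G K \<Longrightarrow> L \<subseteq> K \<Longrightarrow> clique G L"
  by (auto simp: clique_def)

lemma clique_proper_card:
  fixes c :: "'a \<Rightarrow> nat"
  assumes "clique G K" "\<And>u v. \<lbrakk>u \<in> K; v \<in> K; u \<rightarrow>\<^bsub>G\<^esub> v\<rbrakk> \<Longrightarrow> c u \<noteq> c v"
  shows "card (c ` K) = card K"
proof (rule card_image, rule inj_onI)
  fix u v assume "u \<in> K" "v \<in> K" "c u = c v"
  with assms show "u = v"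
    unfolding clique_def by metis
qed

lemma (in graph) finite_cliques: "finite {K. clique G K}"
  by (rule finite_subset[of _ "Pow (verts G)"]) (auto simp: clique_def)

lemma (in graph) adj_induce_iff: "u \<rightarrow>\<^bsub>G \<restriction> B\<^esub> v \<longleftrightarrow> u \<rightarrow> v \<and> u \<in> B \<and> v \<in> B"
  by (auto simp: arcs_ends_conv)

lemma (in graph) clique_induce_iff:
  "B \<subseteq> verts G \<Longrightarrow> clique (G \<restriction> B) K \<longleftrightarrow> clique G K \<and> K \<subseteq> B"
  by (auto simp: clique_def adj_induce_iff)

text \<open>Perfection is applied to the subgraph induced by \<open>B\<close>: its chromatic number
  equals its clique number, which is at most \<open>m\<close>.\<close>

lemma (in graph) perfect_colouring:
  assumes "perfect G" "B \<subseteq> verts G"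
    and "\<And>K. clique G K \<Longrightarrow> K \<subseteq> B \<Longrightarrow> card K \<le> m"
  obtains c where "\<And>x. x \<in> B \<Longrightarrow> c x \<in> {1..m}"
    "\<And>x y. \<lbrakk>x \<in> B; y \<in> B; x \<rightarrow> y\<rbrakk> \<Longrightarrow> c x \<noteq> c y"
proof -
  let ?H = "G \<restriction> B"
  let ?P = "\<lambda>k c. proper_colouring ?H c \<and> c ` B \<subseteq> {1..k}"
  have fin: "finite B"
    using assms(2) finite_verts finite_subset by blast
  \<comment> \<open>An injective colouring is proper since there are no loops. It shows that the
    \<open>LEAST\<close> in \<open>chromatic_number\<close> is attained.\<close>
  obtain f where f: "bij_betw f B {1..card B}"
    using ex_bij_betw_finite_nat[OF fin] finite_same_card_bij[OF fin, of "{1..card B}"] by auto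
  then have "?P (card B) f"
    using adj_not_same unfolding proper_colouring_def adj_induce_iff bij_betw_def inj_on_def
    by blast
  then have "\<exists>c. ?P (chromatic_number ?H) c"
    unfolding chromatic_number_def induce_subgraph_verts
    by (intro LeastI_ex[where P = "\<lambda>k. \<exists>c. ?P k c"]) blast
  then obtain c where c: "?P (chromatic_number ?H) c"
    by blast
  have "chromatic_number ?H = clique_number ?H"
    using assms(1,2) induced_induce unfolding perfect_def by blast
  also have "\<dots> = Max (card ` {K. clique G K \<and> K \<subseteq> B})"
    by (simp add: clique_number_def clique_induce_iff[OF assms(2)])
  also have "\<dots> \<le> m"
  proof (subst Max_le_iff)
    show "finite (card ` {K. clique G K \<and> K \<subseteq> B})"
      using finite_cliques by simp
    have "clique G {}"
      by (simp add: clique_def)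
    then show "card ` {K. clique G K \<and> K \<subseteq> B} \<noteq> {}"
      by blast
  qed (use assms(3) in blast)
  finally have "{1..chromatic_number ?H} \<subseteq> {1..m}"
    by auto
  with c show thesis
    by (intro that[of c]) (auto simp: proper_colouring_def adj_induce_iff)
qed

section \<open>Root-connected sets\<close>

text \<open>Every vertex of \<open>A\<close> is reachable from \<open>v\<close> by a walk that stays
  in \<open>A\<close> after its start. The closure form serves directly as an induction
  principle.\<close>

definition rooted :: "('a, 'b) pre_digraph \<Rightarrow> 'a set \<Rightarrow> 'a \<Rightarrow> bool" where
  "rooted G A v \<longleftrightarrow>
     (\<forall>X. v \<in> X \<longrightarrow> (\<forall>x\<in>X. \<forall>y\<in>A. x \<rightarrow>\<^bsub>G\<^esub> y \<longrightarrow> y \<in> X) \<longrightarrow> A \<subseteq> X)"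

lemma rootedD:
  assumes "rooted G A v" "v \<in> X" "\<And>x y. \<lbrakk>x \<in> X; y \<in> A; x \<rightarrow>\<^bsub>G\<^esub> y\<rbrakk> \<Longrightarrow> y \<in> X"
  shows "A \<subseteq> X"
  using assms unfolding rooted_def by blast

text \<open>\<open>D\<close> is the component of \<open>v\<close> in the subgraph induced by
  \<open>B\<close>: the vertices reached from \<open>v\<close> by walks within
  \<open>B\<close>.\<close>

lemma exists_component:
  assumes "v \<in> B"
  obtains D where "D \<subseteq> B" "v \<in> D" "rooted G D v"
    "\<And>x y. \<lbrakk>x \<in> D; y \<in> B; x \<rightarrow>\<^bsub>G\<^esub> y\<rbrakk> \<Longrightarrow> y \<in> D"
proof
  let ?D = "{d. (v, d) \<in> rtrancl_on B (arcs_ends G)}"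
  show "?D \<subseteq> B"
    using in_rtrancl_on_in_F by fastforce
  show "v \<in> ?D"
    using assms by simp
  show "y \<in> ?D" if "x \<in> ?D" "y \<in> B" "x \<rightarrow>\<^bsub>G\<^esub> y" for x y
    using that by (auto intro: rtrancl_on_into_rtrancl_on)
  show "rooted G ?D v"
    unfolding rooted_def
  proof (intro allI impI subsetI)
    fix X d
    assume X: "v \<in> X" "\<forall>x\<in>X. \<forall>y\<in>?D. x \<rightarrow>\<^bsub>G\<^esub> y \<longrightarrow> y \<in> X" and "d \<in> ?D"
    then have "(v, d) \<in> rtrancl_on B (arcs_ends G)"
      by simp
    then show "d \<in> X"
    proof (induction rule: rtrancl_on_induct)
      case (step y z)
      then have "z \<in> ?D"
        by (auto intro: rtrancl_on_into_rtrancl_on)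
      with step X(2) show ?case by blast
    qed (rule X(1))
  qed
qed

section \<open>Exploring along a stable transversal\<close>

text \<open>When the cliques in \<open>A\<close> have at most \<open>m + 1\<close> vertices, the
  last condition says that the stable set \<open>S\<close> meets all cliques of that size.\<close>

definition transversal :: "('a, 'b) pre_digraph \<Rightarrow> 'a set \<Rightarrow> nat \<Rightarrow> 'a set \<Rightarrow> bool" where
  "transversal G A m S \<longleftrightarrow> S \<subseteq> A \<and> (\<forall>x\<in>S. \<forall>y\<in>S. \<not> x \<rightarrow>\<^bsub>G\<^esub> y) \<and>
     (\<forall>K. clique G K \<longrightarrow> K \<subseteq> A - S \<longrightarrow> card K \<le> m)"

text \<open>
  A vertex of the transversal \<open>S\<close> is entered only from an \<open>m\<close>-clique outside \<open>S\<close>. If \<open>m\<close> colours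
  are used outside \<open>S\<close>, that clique shows all of them, so the vertex greedily receives colour
  \<open>m + 1\<close> and cannot disturb the components of \<open>A - S\<close> entered from it.
\<close>

inductive_set explored :: "('a, 'b) pre_digraph \<Rightarrow> 'a set \<Rightarrow> 'a \<Rightarrow> nat \<Rightarrow> 'a set \<Rightarrow> 'a set"
  for G :: "('a, 'b) pre_digraph" and A :: "'a set" and v :: 'a and m :: nat and S :: "'a set"
  where
    root: "v \<in> explored G A v m S"
  | step: "\<lbrakk>a \<in> explored G A v m S; a \<rightarrow>\<^bsub>G\<^esub> b; b \<in> A; a \<in> S \<or> b \<notin> S\<rbrakk> \<Longrightarrow> b \<in> explored G A v m S"
  | enter: "\<lbrakk>clique G K; card K = m; b \<in> S; b \<in> A;
      \<forall>x\<in>K. x \<in> explored G A v m S \<and> x \<notin> S \<and> x \<rightarrow>\<^bsub>G\<^esub> b\<rbrakk> \<Longrightarrow> b \<in> explored G A v m S"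

lemma explored_subset: "v \<in> A \<Longrightarrow> explored G A v m S \<subseteq> A"
proof
  fix x assume "x \<in> explored G A v m S" "v \<in> A"
  then show "x \<in> A"
    by (induction rule: explored.induct) auto
qed

text \<open>The rules test membership in \<open>S\<close> only for vertices that are explored
  already or become explored by that rule. Hence \<open>S\<close> may be changed freely outside the
  explored set.\<close>

lemma explored_mono:
  assumes "\<And>x. x \<in> explored G A v m S \<Longrightarrow> x \<in> S \<longleftrightarrow> x \<in> S'"
  shows "explored G A v m S \<subseteq> explored G A v m S'"
proof
  fix x assume "x \<in> explored G A v m S"
  then show "x \<in> explored G A v m S'"
  proof (induction rule: explored.induct)
    case root
    show ?case by (rule explored.root)
  next
    case (step a b)
    have "b \<in> explored G A v m S"
      by (rule explored.step[OF step.hyps])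
    then have "a \<in> S' \<or> b \<notin> S'"
      using step.hyps(1,4) assms by blast
    then show ?case
      by (rule explored.step[OF step.IH step.hyps(2,3)])
  next
    case (enter K b)
    have "b \<in> explored G A v m S"
      using enter.IH by (intro explored.enter[OF enter.hyps]) blast
    then have "b \<in> S'"
      using enter.hyps(3) assms by blast
    moreover have "\<forall>x\<in>K. x \<in> explored G A v m S' \<and> x \<notin> S' \<and> x \<rightarrow>\<^bsub>G\<^esub> b"
      using enter.IH assms by blast
    ultimately show ?case
      by (rule explored.enter[OF enter.hyps(1,2) _ enter.hyps(4)])
  qed
qed

context graph
begin

text \<open>A colour class of a colouring with \<open>Suc m\<close> colours works, because a clique
  that misses this class shows at most \<open>m\<close> colours.\<close>

lemma exists_transversal:
  assumes "perfect G" "A \<subseteq> verts G" "1 \<le> m"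
    and "\<And>K. clique G K \<Longrightarrow> K \<subseteq> A \<Longrightarrow> card K \<le> Suc m"
  obtains S where "transversal G A m S" "v \<notin> S"
proof -
  obtain c where c: "\<And>x. x \<in> A \<Longrightarrow> c x \<in> {1..Suc m}"
    "\<And>x y. \<lbrakk>x \<in> A; y \<in> A; x \<rightarrow> y\<rbrakk> \<Longrightarrow> c x \<noteq> c y"
    using perfect_colouring[OF assms(1,2,4)] by blast
  \<comment> \<open>Since \<open>m \<ge> 1\<close> there are at least two colours, so a class not
    containing \<open>v\<close> can be chosen.\<close>
  define j where "j = (if c v = 1 then 2 else 1 :: nat)"
  have j: "j \<in> {1..Suc m}" "c v \<noteq> j"
    using assms(3) by (auto simp: j_def)
  let ?S = "{x \<in> A. c x = j}"
  have "card K \<le> m" if K: "clique G K" "K \<subseteq> A - ?S" for K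
  proof -
    have "card K = card (c ` K)"
      by (rule clique_proper_card[OF K(1), symmetric]) (use K(2) c(2) in blast)
    also have "c ` K \<subseteq> {1..Suc m} - {j}"
      using K(2) c(1) by blast
    then have "card (c ` K) \<le> card ({1..Suc m} - {j})"
      by (intro card_mono) auto
    finally show ?thesis
      using j(1) by simp
  qed
  then have "transversal G A m ?S"
    using c(2) unfolding transversal_def by (metis (mono_tags, lifting) mem_Collect_eq subsetI)
  with j(2) show thesis
    by (intro that[of ?S]) auto
qed

text \<open>
  If the exploration \<open>X\<close> stops early, it is enlarged by exchanging \<open>S\<close> outside \<open>X\<close> for another
  colour class: this frees the vertices of \<open>S\<close> that are adjacent to \<open>X\<close>.
\<close>

lemma explored_improve:
  assumes "perfect G" "A \<subseteq> verts G" "1 \<le> m" "v \<in> A" "rooted G A v"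
    and S: "transversal G A m S" "v \<notin> S" and "explored G A v m S \<noteq> A"
  obtains S' where "transversal G A m S'" "v \<notin> S'" "explored G A v m S \<subset> explored G A v m S'"
proof -
  define X where "X = explored G A v m S"
  have XA: "X \<subseteq> A" and vX: "v \<in> X"
    using explored_subset[OF assms(4)] by (auto simp: X_def intro: explored.root)
  have Xstep: "b \<in> X" if "a \<in> X" "a \<rightarrow> b" "b \<in> A" "a \<in> S \<or> b \<notin> S" for a b
    using explored.step[OF that[unfolded X_def]] by (simp add: X_def)
  have Xenter: "b \<in> X" if "clique G K" "card K = m" "b \<in> S" "b \<in> A"
    "\<And>x. x \<in> K \<Longrightarrow> x \<in> X - S \<and> x \<rightarrow> b" for b K
  proof -
    have "\<forall>x\<in>K. x \<in> explored G A v m S \<and> x \<notin> S \<and> x \<rightarrow> b"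
      using that(5) by (simp add: X_def)
    then show ?thesis
      unfolding X_def by (rule explored.enter[OF that(1-4)])
  qed
  have "\<not> A \<subseteq> X"
    using XA assms(8) unfolding X_def by blast
  then obtain x y where xy: "x \<in> X" "y \<in> A" "y \<notin> X" "x \<rightarrow> y"
    using rootedD[OF assms(5) vX] by blast
  have SA: "S \<subseteq> A" and stable: "\<And>a b. a \<in> S \<Longrightarrow> b \<in> S \<Longrightarrow> \<not> a \<rightarrow> b"
    and hit: "\<And>K. clique G K \<Longrightarrow> K \<subseteq> A - S \<Longrightarrow> card K \<le> m"
    using S(1) by (auto simp: transversal_def)
  \<comment> \<open>Cliques avoiding \<open>S\<close> have at most \<open>m\<close> vertices, so
    perfection colours this set with \<open>m\<close> colours.\<close>
  let ?B = "A - X - S"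
  obtain c where c: "\<And>x. x \<in> ?B \<Longrightarrow> c x \<in> {1..m}"
    "\<And>x y. \<lbrakk>x \<in> ?B; y \<in> ?B; x \<rightarrow> y\<rbrakk> \<Longrightarrow> c x \<noteq> c y"
  proof (rule perfect_colouring[OF assms(1)])
    show "card K \<le> m" if "clique G K" "K \<subseteq> ?B" for K
      using that by (intro hit) auto
  qed (use assms(2) in auto)
  \<comment> \<open>Any of the \<open>m\<close> colours would do in place of 1. The class
    \<open>C\<close> takes over the role of \<open>S - X\<close>.\<close>
  define C where "C = {x \<in> ?B. c x = 1}"
  define S' where "S' = (X \<inter> S) \<union> C"
  have clique_S: "a = b" if "clique G K" "a \<in> K \<inter> S" "b \<in> K \<inter> S" for K a b
    using that stable unfolding clique_def by blast
  have "card K \<le> m" if K: "clique G K" "K \<subseteq> A - S'" for K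
  proof (rule ccontr)
    assume "\<not> card K \<le> m"
    have KA: "K \<subseteq> A" and KS: "K \<inter> X \<inter> S = {}" and KC: "K \<inter> C = {}"
      using K(2) by (auto simp: S'_def)
    have "finite K"
      using KA assms(2) by (intro finite_subset[OF _ finite_verts]) simp
    have "\<not> K \<subseteq> A - S"
      using hit[OF K(1)] \<open>\<not> card K \<le> m\<close> by blast
    \<comment> \<open>A clique with more than \<open>m\<close> vertices must meet the stable set
      \<open>S\<close>, and does so in a single vertex \<open>b\<close>. The remaining vertices form
      an \<open>m\<close>-clique outside \<open>S\<close>.\<close>
    then obtain b where b: "b \<in> K" "b \<in> S"
      using KA by blast
    then have rest: "K - {b} \<subseteq> A - S"
      using clique_S[OF K(1)] KA by blast
    have cl: "clique G (K - {b})"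
      by (rule clique_subset[OF K(1)]) auto
    have "card (K - {b}) \<le> m"
      by (rule hit[OF cl rest])
    then have card: "card (K - {b}) = m"
      using \<open>\<not> card K \<le> m\<close> \<open>finite K\<close> b(1) by simp
    have "b \<notin> X"
      using b KS by blast
    \<comment> \<open>One explored vertex of \<open>K\<close> would make all of
      \<open>K - {b}\<close> explored by the step rule, and then \<open>b\<close> would be entered
      from this \<open>m\<close>-clique.\<close>
    have "K \<inter> X = {}"
    proof (rule ccontr)
      assume "K \<inter> X \<noteq> {}"
      then obtain a where a: "a \<in> K" "a \<in> X" "a \<notin> S"
        using KS by blast
      have "z \<in> X - S" if z: "z \<in> K - {b}" for z
      proof (cases "z = a")
        case False
        then have "a \<rightarrow> z"
          using K(1) a(1) z by (auto simp: clique_def)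
        then show ?thesis
          using Xstep[OF a(2)] rest z by blast
      qed (use a in simp)
      moreover have "z \<rightarrow> b" if "z \<in> K - {b}" for z
        using K(1) b(1) that by (auto simp: clique_def)
      ultimately have "b \<in> X"
        using b(1) KA by (intro Xenter[OF cl card b(2)]) auto
      with \<open>b \<notin> X\<close> show False ..
    qed
    \<comment> \<open>Now \<open>K - {b}\<close> is an \<open>m\<close>-clique of the
      \<open>m\<close>-coloured part, so it shows every colour, in particular 1, and meets
      \<open>C\<close>.\<close>
    then have sub: "K - {b} \<subseteq> ?B"
      using rest by blast
    have "card (c ` (K - {b})) = m"
      using clique_proper_card[OF cl, of c] c(2) sub card by blast
    moreover have "c ` (K - {b}) \<subseteq> {1..m}"
      using c(1) sub by blast
    ultimately have "c ` (K - {b}) = {1..m}"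
      by (intro card_subset_eq) auto
    then have "1 \<in> c ` (K - {b})"
      using assms(3) by simp
    then show False
      using sub KC by (auto simp: C_def)
  qed
  \<comment> \<open>The mixed case is excluded because a vertex of \<open>X \<inter> S\<close>
    passes the exploration on to all its neighbours in \<open>A\<close>, while \<open>C\<close> is
    disjoint from \<open>X\<close>.\<close>
  moreover have "\<not> a \<rightarrow> b" if "a \<in> S'" "b \<in> S'" for a b
  proof
    assume ab: "a \<rightarrow> b"
    then have ba: "b \<rightarrow> a"
      by (rule graph_symmetric)
    show False
      using that stable ab ba c(2)[OF _ _ ab] Xstep[OF _ ab] Xstep[OF _ ba]
      by (auto simp: S'_def C_def)
  qed
  moreover have "S' \<subseteq> A"
    using SA by (auto simp: S'_def C_def)
  ultimately have "transversal G A m S'"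
    unfolding transversal_def by blast
  moreover have "v \<notin> S'"
    using S(2) vX by (auto simp: S'_def C_def)
  moreover have "X \<subset> explored G A v m S'"
  proof
    show sub: "X \<subseteq> explored G A v m S'"
      unfolding X_def by (rule explored_mono) (auto simp: S'_def C_def X_def)
    \<comment> \<open>Only membership in \<open>S\<close> can have blocked the step from
      \<open>x\<close> to \<open>y\<close>. As \<open>y\<close> is not in \<open>S'\<close>, this
      step is now allowed.\<close>
    have "y \<in> S"
      using Xstep[OF xy(1,4,2)] xy(3) by blast
    then have "y \<notin> S'"
      using xy(3) by (auto simp: S'_def C_def)
    then have "y \<in> explored G A v m S'"
      using sub xy(1) by (intro explored.step[OF _ xy(4,2)]) auto
    with xy(3) show "X \<noteq> explored G A v m S'"
      by blast
  qed
  ultimately show thesis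
    using that by (simp add: X_def)
qed

text \<open>Among the transversals avoiding \<open>v\<close>, one with the largest explored set must
  explore all of \<open>A\<close>, since otherwise it could be improved.\<close>

lemma exists_exploring_transversal:
  assumes "perfect G" "A \<subseteq> verts G" "1 \<le> m" "v \<in> A" "rooted G A v"
    and "\<And>K. clique G K \<Longrightarrow> K \<subseteq> A \<Longrightarrow> card K \<le> Suc m"
  obtains S where "transversal G A m S" "v \<notin> S" "explored G A v m S = A"
proof -
  let ?P = "\<lambda>S. transversal G A m S \<and> v \<notin> S"
  let ?f = "\<lambda>S. card (explored G A v m S)"
  have fin: "finite A"
    using assms(2) finite_verts finite_subset by blast
  have finX: "finite (explored G A v m S)" for S
    by (rule finite_subset[OF explored_subset[OF assms(4)] fin])
  obtain S0 where "?P S0"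
    using exists_transversal[OF assms(1-3,6)] by blast
  moreover have "\<forall>S. ?P S \<longrightarrow> ?f S < Suc (card A)"
    by (simp add: less_Suc_eq_le card_mono[OF fin explored_subset[OF assms(4)]])
  ultimately have "\<exists>S. ?P S \<and> (\<forall>S'. ?P S' \<longrightarrow> ?f S' \<le> ?f S)"
    by (rule ex_has_greatest_nat)
  then obtain S where S: "?P S" "\<And>S'. ?P S' \<Longrightarrow> ?f S' \<le> ?f S"
    by blast
  have "explored G A v m S = A"
  proof (rule ccontr)
    assume "explored G A v m S \<noteq> A"
    then obtain S' where S': "?P S'" "explored G A v m S \<subset> explored G A v m S'"
      using explored_improve[OF assms(1-5), of S] S(1) by metis
    then show False
      using S(2)[OF S'(1)] psubset_card_mono[OF finX S'(2)] by simp
  qed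
  with S(1) that show thesis by blast
qed

section \<open>Colouring along the exploration\<close>

text \<open>The \<open>m\<close> vertices of \<open>K\<close> have distinct colours in
  \<open>{1..m}\<close>, so they block all of these. Colour \<open>Suc m\<close> is free because no
  coloured neighbour of \<open>b\<close> exceeds \<open>m\<close>.\<close>

lemma greedy_saturated:
  assumes "clique G K" "card K = m" "distinct \<sigma>" "K \<subseteq> set \<sigma>"
    and "\<And>x. x \<in> K \<Longrightarrow> x \<rightarrow> b"
    and "\<And>x. \<lbrakk>x \<in> set \<sigma>; x \<rightarrow> b\<rbrakk> \<Longrightarrow> the (greedy_colouring G \<sigma> x) \<le> m"
  shows "greedy_colouring G (\<sigma> @ [b]) = (greedy_colouring G \<sigma>)(b \<mapsto> Suc m)"
proof -
  let ?c = "greedy_colouring G \<sigma>"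
  have c: "?c x = Some (the (?c x))" if "x \<in> set \<sigma>" for x
    using that dom_greedy_colouring[of G \<sigma>] by force
  obtain k where k: "greedy_colouring G (\<sigma> @ [b]) = ?c(b \<mapsto> k)" "1 \<le> k"
    "\<And>u. u \<rightarrow> b \<Longrightarrow> ?c u \<noteq> Some k"
    "\<And>j. \<lbrakk>1 \<le> j; \<And>u. u \<rightarrow> b \<Longrightarrow> ?c u \<noteq> Some j\<rbrakk> \<Longrightarrow> k \<le> j"
    using greedy_colouring_snoc[of G \<sigma> b] by blast
  have "card ((\<lambda>x. the (?c x)) ` K) = m"
    unfolding assms(2)[symmetric]
  proof (rule clique_proper_card[OF assms(1)])
    fix u v assume uv: "u \<in> K" "v \<in> K" "u \<rightarrow> v"
    then have "?c u \<noteq> ?c v"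
      using greedy_colouring_proper[OF assms(3)] assms(4) by blast
    moreover have "?c u = Some (the (?c u))" "?c v = Some (the (?c v))"
      using uv(1,2) assms(4) c by blast+
    ultimately show "the (?c u) \<noteq> the (?c v)"
      by metis
  qed
  moreover have "(\<lambda>x. the (?c x)) ` K \<subseteq> {1..m}"
  proof (rule image_subsetI)
    fix x assume "x \<in> K"
    then have x: "x \<in> set \<sigma>" "x \<rightarrow> b"
      using assms(4,5) by auto
    show "the (?c x) \<in> {1..m}"
      using greedy_colouring_pos[OF c[OF x(1)]] assms(6)[OF x] by simp
  qed
  ultimately have "(\<lambda>x. the (?c x)) ` K = {1..m}"
    by (intro card_subset_eq) auto
  moreover have "k \<notin> (\<lambda>x. the (?c x)) ` K"
  proof
    assume "k \<in> (\<lambda>x. the (?c x)) ` K"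
    then obtain x where x: "x \<in> K" "k = the (?c x)"
      by blast
    have "?c x = Some k"
      using c[of x] x assms(4) by auto
    then show False
      using k(3)[OF assms(5)[OF x(1)]] by simp
  qed
  ultimately have "Suc m \<le> k"
    using k(2) by auto
  moreover have "k \<le> Suc m"
  proof (rule k(4))
    show "?c u \<noteq> Some (Suc m)" if "u \<rightarrow> b" for u
    proof
      assume Suc: "?c u = Some (Suc m)"
      then have "u \<in> set \<sigma>"
        using dom_greedy_colouring[of G \<sigma>] by blast
      then show False
        using assms(6)[OF _ that] Suc by simp
    qed
  qed simp
  ultimately show ?thesis
    using k(1) by simp
qed

text \<open>A longest search order satisfying a suitable invariant contains every explored vertex,
  because a rule leading outside it would allow an extension.\<close>

lemma exists_greedy_order_explored:
  assumes "A \<subseteq> verts G" "1 \<le> m" "v \<in> A"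
    and S: "transversal G A m S" "v \<notin> S" "explored G A v m S = A"
    and IH: "\<And>D w. \<lbrakk>D \<subseteq> A - S; w \<in> D; rooted G D w\<rbrakk> \<Longrightarrow>
      \<exists>\<tau>. search_order G w \<tau> \<and> set \<tau> = D \<and> ran (greedy_colouring G \<tau>) \<subseteq> {1..m}"
  shows "\<exists>\<sigma>. search_order G v \<sigma> \<and> set \<sigma> = A \<and> ran (greedy_colouring G \<sigma>) \<subseteq> {1..Suc m}"
proof -
  \<comment> \<open>The invariant: colours at most \<open>m\<close> outside \<open>S\<close>,
    exactly \<open>Suc m\<close> on \<open>S\<close>, and the part outside \<open>S\<close> is a
    union of whole components of the graph on \<open>A - S\<close>.\<close>
  define P where "P = (\<lambda>\<sigma>. search_order G v \<sigma> \<and> set \<sigma> \<subseteq> A \<and>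
    (\<forall>x\<in>set \<sigma> - S. the (greedy_colouring G \<sigma> x) \<le> m) \<and>
    (\<forall>x\<in>set \<sigma> \<inter> S. greedy_colouring G \<sigma> x = Some (Suc m)) \<and>
    (\<forall>a\<in>set \<sigma> - S. \<forall>b\<in>A - S. a \<rightarrow> b \<longrightarrow> b \<in> set \<sigma>))"
  have stable: "\<And>a b. a \<in> S \<Longrightarrow> b \<in> S \<Longrightarrow> \<not> a \<rightarrow> b"
    using S(1) by (auto simp: transversal_def)
  have component: "\<exists>D \<tau>. D \<subseteq> A - S \<and> rooted G D w \<and> search_order G w \<tau> \<and> set \<tau> = D \<and>
      ran (greedy_colouring G \<tau>) \<subseteq> {1..m} \<and> (\<forall>a\<in>D. \<forall>b\<in>A - S. a \<rightarrow> b \<longrightarrow> b \<in> D)"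
    if "w \<in> A - S" for w
    using exists_component[OF that, of G] IH by (smt (verit, best))
  have le_m: "the (greedy_colouring G \<tau> x) \<le> m"
    if \<tau>: "ran (greedy_colouring G \<tau>) \<subseteq> {1..m}" "x \<in> set \<tau>" for \<tau> x
  proof -
    obtain k where "greedy_colouring G \<tau> x = Some k"
      using \<tau>(2) dom_greedy_colouring[of G \<tau>] by blast
    with \<tau>(1) show ?thesis
      by (auto simp: ran_def)
  qed
  obtain D \<sigma>0 where "D \<subseteq> A - S" "search_order G v \<sigma>0" "set \<sigma>0 = D"
    "ran (greedy_colouring G \<sigma>0) \<subseteq> {1..m}" "\<forall>a\<in>D. \<forall>b\<in>A - S. a \<rightarrow> b \<longrightarrow> b \<in> D"
    using component[of v] assms(3) S(2) by blast
  then have "P \<sigma>0"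
    using le_m[of \<sigma>0] by (auto simp: P_def)
  moreover have "\<forall>\<sigma>. P \<sigma> \<longrightarrow> length \<sigma> < Suc (card A)"
  proof (intro allI impI)
    fix \<sigma> assume "P \<sigma>"
    have "finite A"
      using assms(1) finite_verts finite_subset by blast
    moreover have "distinct \<sigma>" "set \<sigma> \<subseteq> A"
      using \<open>P \<sigma>\<close> search_order_distinct by (auto simp: P_def)
    ultimately show "length \<sigma> < Suc (card A)"
      using card_mono distinct_card less_Suc_eq_le by metis
  qed
  ultimately have "\<exists>\<sigma>. P \<sigma> \<and> (\<forall>\<tau>. P \<tau> \<longrightarrow> length \<tau> \<le> length \<sigma>)"
    by (rule ex_has_greatest_nat)
  then obtain \<sigma> where \<sigma>: "P \<sigma>" and max: "\<And>\<tau>. P \<tau> \<Longrightarrow> length \<tau> \<le> length \<sigma>"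
    by blast
  let ?c = "greedy_colouring G \<sigma>"
  have order: "search_order G v \<sigma>" and sub: "set \<sigma> \<subseteq> A"
    and low: "\<And>x. \<lbrakk>x \<in> set \<sigma>; x \<notin> S\<rbrakk> \<Longrightarrow> the (?c x) \<le> m"
    and high: "\<And>x. \<lbrakk>x \<in> set \<sigma>; x \<in> S\<rbrakk> \<Longrightarrow> ?c x = Some (Suc m)"
    and closed: "\<And>a b. \<lbrakk>a \<in> set \<sigma>; a \<notin> S; b \<in> A; b \<notin> S; a \<rightarrow> b\<rbrakk> \<Longrightarrow> b \<in> set \<sigma>"
    using \<sigma> by (auto simp: P_def)
  have "explored G A v m S \<subseteq> set \<sigma>"
  proof
    fix x assume "x \<in> explored G A v m S"
    then show "x \<in> set \<sigma>"
    proof (induction rule: explored.induct)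
      case root
      show ?case by (rule search_order_root[OF order])
    next
      case (step a b)
      show ?case
      proof (rule ccontr)
        assume b: "b \<notin> set \<sigma>"
        then have aS: "a \<in> S"
          using step closed by blast
        then have bS: "b \<in> A - S"
          using step stable by blast
        obtain D \<tau> where D: "D \<subseteq> A - S" "rooted G D b" and \<tau>: "search_order G b \<tau>" "set \<tau> = D"
          "ran (greedy_colouring G \<tau>) \<subseteq> {1..m}"
          and D_closed: "\<And>a b. \<lbrakk>a \<in> D; b \<in> A - S; a \<rightarrow> b\<rbrakk> \<Longrightarrow> b \<in> D"
          using component[OF bS] by blast
        \<comment> \<open>The component \<open>D\<close> of \<open>b\<close> starts outside
          \<open>\<sigma>\<close>. An edge of \<open>D\<close> into \<open>\<sigma>\<close> would,
          by \<open>closed\<close> and symmetry, put its other end into \<open>\<sigma>\<close>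
          too.\<close>
        have "D \<subseteq> - set \<sigma>"
        proof -
          have "D \<subseteq> D - set \<sigma>"
          proof (rule rootedD[OF D(2)])
            show "b \<in> D - set \<sigma>"
              using b \<tau>(2) search_order_root[OF \<tau>(1)] by blast
            show "y \<in> D - set \<sigma>" if "x \<in> D - set \<sigma>" "y \<in> D" "x \<rightarrow> y" for x y
              using that closed[of y x] D(1) graph_symmetric[OF that(3)] by blast
          qed
          then show ?thesis by blast
        qed
        then have disj: "set \<sigma> \<inter> set \<tau> = {}"
          using \<tau>(2) by blast
        \<comment> \<open>The only vertices of \<open>\<sigma>\<close> adjacent to
          \<open>\<tau>\<close> lie in \<open>S\<close> and have colour \<open>Suc m\<close>, so
          \<open>\<tau>\<close> is coloured as if it stood alone.\<close>
        have col: "greedy_colouring G (\<sigma> @ \<tau>) = ?c ++ greedy_colouring G \<tau>"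
        proof (rule greedy_colouring_append[OF \<tau>(3)])
          fix u w j assume uw: "u \<rightarrow> w" "w \<in> set \<tau>" "?c u = Some j"
          then have u: "u \<in> set \<sigma>"
            using dom_greedy_colouring[of G \<sigma>] by blast
          have "w \<in> A - S" "w \<notin> set \<sigma>"
            using uw(2) \<tau>(2) D(1) disj by auto
          then have "u \<in> S"
            using closed[OF u _ _ _ uw(1)] by blast
          then show "m < j"
            using high[OF u] uw(3) by simp
        qed (use disj search_order_distinct[OF \<tau>(1)] in auto)
        have new: "greedy_colouring G (\<sigma> @ \<tau>) x = greedy_colouring G \<tau> x" if "x \<in> D" for x
          using that \<tau>(2) unfolding col
          by (simp add: map_add_dom_app_simps dom_greedy_colouring)
        have old: "greedy_colouring G (\<sigma> @ \<tau>) x = ?c x" if "x \<in> set \<sigma>" for x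
          using that disj unfolding col
          by (intro map_add_dom_app_simps(3)) (auto simp: dom_greedy_colouring)
        have "P (\<sigma> @ \<tau>)"
          unfolding P_def
        proof (intro conjI ballI impI)
          show "search_order G v (\<sigma> @ \<tau>)"
            by (rule search_order_append[OF \<tau>(1) order step.IH step.hyps(2) disj])
          show "set (\<sigma> @ \<tau>) \<subseteq> A"
            using sub D(1) \<tau>(2) by auto
          show "the (greedy_colouring G (\<sigma> @ \<tau>) x) \<le> m" if "x \<in> set (\<sigma> @ \<tau>) - S" for x
            using that new old low le_m[OF \<tau>(3)] \<tau>(2) by auto
          show "greedy_colouring G (\<sigma> @ \<tau>) x = Some (Suc m)" if "x \<in> set (\<sigma> @ \<tau>) \<inter> S" for x
            using that old high D(1) \<tau>(2) by auto
          show "z \<in> set (\<sigma> @ \<tau>)" if "y \<in> set (\<sigma> @ \<tau>) - S" "z \<in> A - S" "y \<rightarrow> z" for y z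
            using that closed D_closed \<tau>(2) by auto
        qed
        then show False
          using max[of "\<sigma> @ \<tau>"] search_order_root[OF \<tau>(1)] by auto
      qed
    next
      case (enter K b)
      show ?case
      proof (rule ccontr)
        assume b: "b \<notin> set \<sigma>"
        \<comment> \<open>As \<open>S\<close> is stable, all neighbours of \<open>b\<close> lie
          outside \<open>S\<close> and have colours at most \<open>m\<close>.\<close>
        have col: "greedy_colouring G (\<sigma> @ [b]) = ?c(b \<mapsto> Suc m)"
        proof (rule greedy_saturated[OF enter(1,2) search_order_distinct[OF order]])
          show "the (?c x) \<le> m" if "x \<in> set \<sigma>" "x \<rightarrow> b" for x
            using that low stable[OF _ enter(3)] by blast
        qed (use enter in auto)
        \<comment> \<open>A vertex of \<open>K\<close> is the earlier neighbour that lets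
          \<open>b\<close> extend the search order.\<close>
        have "K \<noteq> {}"
          using enter(2) assms(2) by auto
        then have "search_order G v (\<sigma> @ [b])"
          using enter b order by (auto intro: search_order.extend)
        then have "P (\<sigma> @ [b])"
          unfolding P_def col using sub low high closed enter b by auto
        then show False
          using max[of "\<sigma> @ [b]"] by simp
      qed
    qed
  qed
  then have set: "set \<sigma> = A"
    using sub S(3) by blast
  have "ran ?c \<subseteq> {1..Suc m}"
  proof
    fix k assume "k \<in> ran ?c"
    then obtain x where x: "?c x = Some k"
      by (auto simp: ran_def)
    then have "x \<in> set \<sigma>"
      using dom_greedy_colouring[of G \<sigma>] by blast
    then have "k \<le> Suc m"
      using low[of x] high[of x] x by (cases "x \<in> S") auto
    then show "k \<in> {1..Suc m}"
      using greedy_colouring_pos[OF x] by simp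
  qed
  with order set show ?thesis by blast
qed

text \<open>The set \<open>A\<close> and the root vary in the induction because the components of
  \<open>A - S\<close> may be entered at any vertex.\<close>

theorem exists_greedy_order:
  assumes "perfect G" "A \<subseteq> verts G" "v \<in> A" "rooted G A v"
    and "\<And>K. clique G K \<Longrightarrow> K \<subseteq> A \<Longrightarrow> card K \<le> k"
  shows "\<exists>\<sigma>. search_order G v \<sigma> \<and> set \<sigma> = A \<and> ran (greedy_colouring G \<sigma>) \<subseteq> {1..k}"
  using assms(2-)
proof (induction k arbitrary: A v)
  case 0
  then have "clique G {v}"
    by (auto simp: clique_def)
  then show ?case
    using 0(2) 0(4)[of "{v}"] by simp
next
  case (Suc m)
  show ?case
  proof (cases "m = 0")
    \<comment> \<open>With a single colour no class can avoid \<open>v\<close>, so this case is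
      separate: cliques have at most one vertex, hence there are no edges in \<open>A\<close> and
      \<open>A = {v}\<close>.\<close>
    case True
    have "A \<subseteq> {v}"
    proof (rule rootedD[OF Suc.prems(3)])
      fix x y assume xy: "x \<in> {v}" "y \<in> A" "x \<rightarrow> y"
      then have "clique G {x, y}"
        using Suc.prems(1,2) graph_symmetric by (auto simp: clique_def)
      then have "card {x, y} \<le> 1"
        using Suc.prems(2) Suc.prems(4)[of "{x, y}"] xy True by simp
      then show "y \<in> {v}"
        using xy by (auto simp: card_insert_if split: if_splits)
    qed simp
    moreover obtain j where j: "greedy_colouring G ([] @ [v]) = (greedy_colouring G [])(v \<mapsto> j)" "1 \<le> j"
      "\<And>i. \<lbrakk>1 \<le> i; \<And>u. u \<rightarrow> v \<Longrightarrow> greedy_colouring G [] u \<noteq> Some i\<rbrakk> \<Longrightarrow> j \<le> i"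
      using greedy_colouring_snoc[of G "[]" v] by blast
    moreover have "j \<le> 1"
      by (rule j(3)) auto
    ultimately show ?thesis
      using Suc.prems(2) by (intro exI[of _ "[v]"]) (auto simp: ran_def intro: search_order.root split: if_splits)
  next
    case False
    then have m: "1 \<le> m"
      by simp
    obtain S where S: "transversal G A m S" "v \<notin> S" "explored G A v m S = A"
      using exists_exploring_transversal[OF assms(1) Suc.prems(1) m Suc.prems(2-4)] by blast
    show ?thesis
    proof (rule exists_greedy_order_explored[OF Suc.prems(1) m Suc.prems(2) S])
      fix D w assume D: "D \<subseteq> A - S" "w \<in> D" "rooted G D w"
      show "\<exists>\<tau>. search_order G w \<tau> \<and> set \<tau> = D \<and> ran (greedy_colouring G \<tau>) \<subseteq> {1..m}"
      proof (rule Suc.IH[OF _ D(2,3)])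
        show "card K \<le> m" if "clique G K" "K \<subseteq> D" for K
          using that D(1) S(1) unfolding transversal_def by blast
      qed (use D(1) Suc.prems(1) in auto)
    qed
  qed
qed

section \<open>Connected orderings of the whole graph and the lower bound\<close>

lemma connected_rooted:
  assumes "connected G" "v \<in> verts G"
  shows "rooted G (verts G) v"
  unfolding rooted_def
proof (intro allI impI subsetI)
  fix X w
  assume X: "v \<in> X" "\<forall>x\<in>X. \<forall>y\<in>verts G. x \<rightarrow> y \<longrightarrow> y \<in> X" and "w \<in> verts G"
  then have "v \<rightarrow>\<^sup>* w"
    using symmetric_connected_imp_strongly_connected[OF sym_arcs assms(1)] assms(2) by blast
  then show "w \<in> X"
    using X(1)
  proof (induction rule: reachable_induct)
    case (step y z)
    then show ?case
      using X(2) adj_in_verts(2) by blast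
  qed
qed

lemma search_order_connected_ordering:
  assumes "search_order G v \<sigma>" "set \<sigma> = verts G"
  shows "connected_ordering G \<sigma>"
proof -
  have "connected (G \<restriction> set (take i \<sigma>))" if "1 \<le> i" for i
    using search_order_connected[OF search_order_take[OF assms(1) that]] assms(2) set_take_subset
    by metis
  then show ?thesis
    using assms search_order_distinct
    by (auto simp: connected_ordering_def vertex_ordering_def)
qed

text \<open>Vertices of a clique receive distinct greedy colours. For a perfect graph this turns the
  upper bound on the number of colours into an equality.\<close>

lemma clique_number_le_greedy_number:
  assumes "vertex_ordering G \<sigma>"
  shows "clique_number G \<le> greedy_number G \<sigma>"
proof -
  let ?c = "greedy_colouring G \<sigma>"
  have \<sigma>: "distinct \<sigma>" "set \<sigma> = verts G"
    using assms by (auto simp: vertex_ordering_def)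
  have fin: "finite (ran ?c)"
    by (simp add: finite_ran dom_greedy_colouring)
  have "card K \<le> card (ran ?c)" if K: "clique G K" for K
  proof -
    have c: "?c x = Some (the (?c x))" if "x \<in> K" for x
      using that K \<sigma>(2) dom_greedy_colouring[of G \<sigma>] by (force simp: clique_def)
    have "card K = card ((\<lambda>x. the (?c x)) ` K)"
    proof (rule clique_proper_card[OF K, symmetric])
      fix u v assume uv: "u \<in> K" "v \<in> K" "u \<rightarrow> v"
      then have "?c u \<noteq> ?c v"
        using greedy_colouring_proper[OF \<sigma>(1)] K \<sigma>(2) by (auto simp: clique_def)
      then show "the (?c u) \<noteq> the (?c v)"
        using c[OF uv(1)] c[OF uv(2)] by metis
    qed
    also have "\<dots> \<le> card (ran ?c)"
      using c by (intro card_mono fin) (auto intro: ranI)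
    finally show ?thesis .
  qed
  moreover have "clique G {}"
    by (simp add: clique_def)
  ultimately show ?thesis
    unfolding clique_number_def greedy_number_def
    using finite_cliques by (subst Max_le_iff) auto
qed

lemma finite_connected_orderings: "finite {\<sigma>. connected_ordering G \<sigma>}"
  by (rule finite_subset[OF _ finite_subset_distinct[OF finite_verts]])
    (auto simp: connected_ordering_def vertex_ordering_def)

end

theorem theorem8:
  fixes G :: "('a, 'b) pre_digraph"
  assumes "graph G"
    and "connected G"
    and "perfect G"
  shows "\<not> ugly G \<and>
    (\<exists>\<sigma>. connected_ordering G \<sigma> \<and> greedy_number G \<sigma> = chromatic_number G)"
proof -
  interpret graph G by fact
  obtain v where v: "v \<in> verts G"
    using assms(2) by (auto simp: connected_def strongly_connected_def)
  have "card K \<le> clique_number G" if "clique G K" for K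
    unfolding clique_number_def using that finite_cliques by (intro Max_ge) auto
  then obtain \<sigma> where \<sigma>: "search_order G v \<sigma>" "set \<sigma> = verts G"
    "ran (greedy_colouring G \<sigma>) \<subseteq> {1..clique_number G}"
    using exists_greedy_order[OF assms(3) order_refl v connected_rooted[OF assms(2) v]] by blast
  have ord: "connected_ordering G \<sigma>"
    using \<sigma>(1,2) by (rule search_order_connected_ordering)
  have "greedy_number G \<sigma> \<le> clique_number G"
    unfolding greedy_number_def using card_mono[OF _ \<sigma>(3)] by simp
  moreover have "clique_number G \<le> greedy_number G \<sigma>"
    using ord by (intro clique_number_le_greedy_number) (simp add: connected_ordering_def)
  moreover have "chromatic_number G = clique_number G"
  proof -
    have "induced_subgraph G G"
      by (auto simp: induced_subgraph_def subgraph_def compatible_def wf_digraph)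
    then show ?thesis
      using assms(3) unfolding perfect_def by blast
  qed
  ultimately have eq: "greedy_number G \<sigma> = chromatic_number G"
    by simp
  have "connected_chromatic_number G \<le> greedy_number G \<sigma>"
    unfolding connected_chromatic_number_def
    using finite_connected_orderings ord by (intro Min_le) auto
  then show ?thesis
    using ord eq by (auto simp: ugly_def)
qed

end
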